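(* Let $X$ and $Y$ be Tychonoff spaces such that $C_p(X)$ and $C_p(Y)$ are homeomorphic (as topological spaces). Then $X$ is projectively Hurewicz if and only if $Y$ is projectively Hurewicz.
   Context: For a Tychonoff space $X$, $C_p(X)$ denotes the set of all continuous functions $X\to\mathbb{R}$ with the topology of pointwise convergence. $\mathbb{N}$ is the set of positive integers. A topological space $Z$ is Hurewicz if for every sequence $(\mathcal{U}_n : n\in\mathbb{N})$ of open covers of $Z$ there is a sequence $(\mathcal{V}_n : n\in\mathbb{N})$ such that, for every $n$, $\mathcal{V}_n$ is a finite subfamily of $\mathcal{U}_n$, and every point of $Z$ is contained in $\bigcup\mathcal{V}_n$ for all but finitely many $n$. A space $X$ is projectively Hurewicz if every separable metrizable continuous image of $X$ is Hurewicz. *)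

theory Defs
  imports "HOL-Analysis.Analysis"
begin

definition Tychonoff_space :: "'a topology \<Rightarrow> bool" where
  "Tychonoff_space X \<longleftrightarrow> completely_regular_space X \<and> Hausdorff_space X"

text \<open>The points of \<open>C\<^sub>p(X)\<close> are the continuous real functions on \<open>X\<close>, each represented by the
  unique function that is \<open>undefined\<close> outside \<open>topspace X\<close> (the carrier of the product topology
  consists of such extensional functions).\<close>

definition Cp :: "'a topology \<Rightarrow> ('a \<Rightarrow> real) topology" where
  "Cp X = subtopology (product_topology (\<lambda>_. euclideanreal) (topspace X))
            {f. continuous_map X euclideanreal f}"

definition open_cover :: "'a topology \<Rightarrow> 'a set set \<Rightarrow> bool" where
  "open_cover Z \<U> \<longleftrightarrow> (\<forall>U\<in>\<U>. openin Z U) \<and> \<Union>\<U> = topspace Z"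

definition Hurewicz_space :: "'a topology \<Rightarrow> bool" where
  "Hurewicz_space Z \<longleftrightarrow>
    (\<forall>\<U> :: nat \<Rightarrow> 'a set set. (\<forall>n. open_cover Z (\<U> n)) \<longrightarrow>
      (\<exists>\<V> :: nat \<Rightarrow> 'a set set. (\<forall>n. finite (\<V> n) \<and> \<V> n \<subseteq> \<U> n) \<and>
         (\<forall>z\<in>topspace Z. \<forall>\<^sub>F n in sequentially. z \<in> \<Union>(\<V> n))))"

text \<open>A definition cannot quantify over all types \<open>Z\<close> may live on, so the images range over
  topologies on the type of \<open>X\<close>. This loses nothing: a continuous image of \<open>X\<close> is homeomorphic
  to one carried by a set of representatives of the fibres. Lemma
  \<open>projectively_Hurewicz_space_image\<close> below gives the property for images of any type.\<close>

definition projectively_Hurewicz_space :: "'a topology \<Rightarrow> bool" where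
  "projectively_Hurewicz_space X \<longleftrightarrow>
    (\<forall>(Z :: 'a topology) f. continuous_map X Z f \<and> f ` topspace X = topspace Z \<and>
        separable_space Z \<and> metrizable_space Z \<longrightarrow> Hurewicz_space Z)"

lemma Hurewicz_space_continuous_image:
  assumes Z: "Hurewicz_space Z" and f: "continuous_map Z W f" and surj: "f ` topspace Z = topspace W"
  shows "Hurewicz_space W"
  unfolding Hurewicz_space_def
proof (intro allI impI)
  fix \<U> :: "nat \<Rightarrow> 'b set set"
  assume \<U>: "\<forall>n. open_cover W (\<U> n)"
  define pre where "pre U = {z \<in> topspace Z. f z \<in> U}" for U
  have "open_cover Z (pre ` \<U> n)" for n
  proof -
    have "openin Z (pre U)" if "U \<in> \<U> n" for U
      using that \<U> f by (auto simp: pre_def open_cover_def continuous_map_def)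
    moreover have "z \<in> \<Union>(pre ` \<U> n)" if "z \<in> topspace Z" for z
    proof -
      have "f z \<in> \<Union>(\<U> n)"
        using that \<U> imageI[of z "topspace Z" f] surj unfolding open_cover_def by metis
      then show ?thesis
        using that by (auto simp: pre_def)
    qed
    moreover have "pre U \<subseteq> topspace Z" for U
      by (auto simp: pre_def)
    ultimately show ?thesis
      unfolding open_cover_def by blast
  qed
  then have "\<exists>\<V>. (\<forall>n. finite (\<V> n) \<and> \<V> n \<subseteq> pre ` \<U> n) \<and>
      (\<forall>z\<in>topspace Z. \<forall>\<^sub>F n in sequentially. z \<in> \<Union>(\<V> n))"
    by (intro Z[unfolded Hurewicz_space_def, rule_format])
  then obtain \<V> where "\<forall>n. finite (\<V> n) \<and> \<V> n \<subseteq> pre ` \<U> n"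
    and "\<forall>z\<in>topspace Z. \<forall>\<^sub>F n in sequentially. z \<in> \<Union>(\<V> n)"
    by (elim exE conjE)
  then have \<V>: "\<And>n. finite (\<V> n)" "\<And>n. \<V> n \<subseteq> pre ` \<U> n"
    and ev: "\<And>z. z \<in> topspace Z \<Longrightarrow> \<forall>\<^sub>F n in sequentially. z \<in> \<Union>(\<V> n)"
    by simp_all
  have "\<exists>C. C \<subseteq> \<U> n \<and> finite C \<and> \<V> n = pre ` C" for n
    using finite_subset_image[OF \<V>(1) \<V>(2)] by blast
  then obtain C where C: "\<And>n. C n \<subseteq> \<U> n \<and> finite (C n) \<and> \<V> n = pre ` C n"
    by metis
  have "\<forall>\<^sub>F n in sequentially. w \<in> \<Union>(C n)" if w: "w \<in> topspace W" for w
  proof -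
    obtain z where z: "z \<in> topspace Z" "w = f z"
      using w surj by blast
    show ?thesis
      using ev[OF z(1)] by eventually_elim (use C z in \<open>auto simp: pre_def\<close>)
  qed
  then show "\<exists>\<V>. (\<forall>n. finite (\<V> n) \<and> \<V> n \<subseteq> \<U> n) \<and>
      (\<forall>z\<in>topspace W. \<forall>\<^sub>F n in sequentially. z \<in> \<Union>(\<V> n))"
    using C by (intro exI[of _ C]) auto
qed

lemma projectively_Hurewicz_space_image:
  fixes X :: "'a topology" and Z :: "'b topology"
  assumes X: "projectively_Hurewicz_space X"
    and f: "continuous_map X Z f" "f ` topspace X = topspace Z"
    and Z: "separable_space Z" "metrizable_space Z"
  shows "Hurewicz_space Z"
proof -
  define s where "s = inv_into (topspace X) f"
  have s: "f (s z) = z" if "z \<in> topspace Z" for z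
    using that f(2) unfolding s_def by (simp add: f_inv_into_f)
  define Z' where "Z' = pullback_topology (s ` topspace Z) f Z"
  have top': "topspace Z' = s ` topspace Z"
    using s by (auto simp: Z'_def topspace_pullback_topology)
  have cf: "continuous_map Z' Z f"
    unfolding Z'_def using continuous_map_pullback[OF continuous_map_id, of "s ` topspace Z" f Z] by simp
  have cs: "continuous_map Z Z' s"
    unfolding Z'_def
  proof (rule continuous_map_pullback')
    show "continuous_map Z Z (f \<circ> s)"
      by (rule continuous_map_eq[OF continuous_map_id]) (simp add: s)
  qed auto
  have hom: "Z homeomorphic_space Z'"
    unfolding homeomorphic_space_def homeomorphic_maps_def
    using cf cs s top' by (intro exI[of _ s] exI[of _ f]) auto
  have "continuous_map X Z' (s \<circ> f)"
    by (rule continuous_map_compose[OF f(1) cs])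
  moreover have "(s \<circ> f) ` topspace X = topspace Z'"
    by (metis image_comp f(2) top')
  moreover have "separable_space Z'" "metrizable_space Z'"
    using Z hom homeomorphic_separable_space homeomorphic_metrizable_space by blast+
  ultimately have "Hurewicz_space Z'"
    using X[unfolded projectively_Hurewicz_space_def, rule_format, of Z' "s \<circ> f"] by blast
  moreover have "f ` topspace Z' = topspace Z"
    using s top' by force
  ultimately show ?thesis
    using Hurewicz_space_continuous_image cf by blast
qed

end

theory Submission
  imports Defs
begin

text \<open>Let \<open>T\<close> map \<open>C\<^sub>p(Y)\<close> continuously to \<open>C\<^sub>p(X)\<close>, with continuous left inverse \<open>T'\<close>, and let \<open>Z\<close> be a
  separable metrizable image of \<open>Y\<close> with open covers \<open>\<U>\<^sub>n\<close>. Countably many bump functions on \<open>Z\<close> give a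
  continuous \<open>e\<close> from \<open>Y\<close> to a compact metrizable cube \<open>K\<close> and turn the problem into the following one:
  open sets \<open>G n k\<close> of \<open>K\<close>, increasing in \<open>k\<close> and covering \<open>e(Y)\<close> for every \<open>n\<close>, are given, and numbers
  \<open>c n\<close> are wanted such that every \<open>e(y)\<close> lies in almost all \<open>G n (c n)\<close>.

  The numbers are found on the other side. Fix a countable family \<open>D\<close> of functions on \<open>K\<close> that is closed
  under products and separates finite sets. The values \<open>T (D\<^sub>l \<circ> e) x - T 0 x\<close> assemble to a continuous map
  \<open>r\<close> from \<open>X\<close> to a countable power of the line. Call a finite tuple \<open>b\<close> of points of \<open>K\<close> a support of
  \<open>r(x)\<close> if \<open>D\<^sub>l < \<epsilon>\<close> on \<open>b\<close> forces the value above to be at most \<open>\<delta>\<close>. By compactness of \<open>K\<close> the points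
  that have a support on a given finite set \<open>M\<close> of positions form a closed set, and supports depend upper
  semicontinuously on the point. Continuity of \<open>T\<close> gives every \<open>r(x)\<close> a support, for every \<open>\<delta>\<close> and a suitable \<open>\<epsilon>\<close>.

  The decisive fact (lemma \<open>supports_response_restrict\<close>) is that the entries of a support that lie outside
  \<open>e(Y)\<close> may be dropped: \<open>T (D\<^sub>l \<circ> e) x\<close> depends, up to a small error, only on finitely many values at
  points of \<open>Y\<close>, so \<open>D\<^sub>l\<close> may be cut down to \<open>0\<close> at the entries outside \<open>e(Y)\<close> without affecting it. Hence,
  if \<open>r(x)\<close> has supports on \<open>M\<close> but on no proper subset of \<open>M\<close>, all its supports on \<open>M\<close> consist of points of
  \<open>e(Y)\<close>. They form a compact set of tuples, and the least \<open>k\<close> for which \<open>G n k\<close> contains all of their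
  entries is locally bounded on the set of such \<open>r(x)\<close>. For each \<open>M\<close> this set is, within \<open>r(X)\<close>, a difference of two closed sets, hence a countable union of
  closed sets, so the Hurewicz property of \<open>r(X)\<close> bounds these \<open>k\<close>, for almost all \<open>n\<close>, by a
  single sequence \<open>c\<close>.

  This sequence works for \<open>Y\<close>. By continuity of \<open>T'\<close> there is a finite \<open>A \<subseteq> X\<close> such that \<open>g(y)\<close> is smaller
  than \<open>1\<close> whenever \<open>T g\<close> is close to \<open>T 0\<close> on \<open>A\<close>. Choose a minimal support of every point of \<open>r(A)\<close>. If
  \<open>e(y)\<close> were not an entry of one of them, some \<open>D\<^sub>l\<close> would vanish on all of them, so that \<open>T (D\<^sub>l \<circ> e)\<close> is
  close to \<open>T 0\<close> on \<open>A\<close>, and equal \<open>1\<close> at \<open>e(y)\<close>, a contradiction. So \<open>e(y)\<close> is an entry of one of these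
  finitely many supports, and for almost all \<open>n\<close> their entries lie in \<open>G n (c n)\<close>.\<close>

section \<open>Compactness and the Hurewicz property\<close>

lemma compact_Pi_UNIV:
  fixes K :: "'c::topological_space set"
  assumes "compact K"
  shows "compact ((UNIV :: 'i set) \<rightarrow> K)"
proof -
  have "compactin (product_topology (\<lambda>_::'i. euclidean) UNIV) (Pi\<^sub>E UNIV (\<lambda>_. K))"
    using assms by (simp add: compactin_PiE)
  then show ?thesis
    by (simp add: euclidean_product_topology PiE_UNIV_domain)
qed

lemma closed_projection_along_compact:
  fixes R :: "('s::topological_space \<times> 't::topological_space) set"
  assumes "closed R" and "compact S"
  shows "closed {x. \<exists>y\<in>S. (x, y) \<in> R}"
proof -
  have "\<exists>T. open T \<and> x \<in> T \<and> T \<subseteq> - {x. \<exists>y\<in>S. (x, y) \<in> R}"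
    if "x \<in> - {x. \<exists>y\<in>S. (x, y) \<in> R}" for x
  proof -
    have "{x} \<times> S \<subseteq> - R"
      using that by auto
    then obtain T where "x \<in> T" "open T" "T \<times> S \<subseteq> - R"
      using Elementary_Topology.tube_lemma[of S "- R" x] assms by (auto simp: open_Compl)
    then show ?thesis
      by (intro exI[of _ T]) auto
  qed
  then have "open (- {x. \<exists>y\<in>S. (x, y) \<in> R})"
    by (rule Topological_Spaces.openI)
  then show ?thesis
    by (simp add: closed_def)
qed

text \<open>This is the form in which the Hurewicz property is used: increasing open covers, indexed by \<open>n\<close> and by a
  further countable parameter \<open>p\<close>, admit one bounding sequence for all \<open>p\<close> at once. Intersecting the covers
  with parameters up to \<open>n\<close> yields a single sequence of covers, and a fixed \<open>p\<close> takes part in it from some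
  \<open>n\<close> on.\<close>

lemma projectively_Hurewicz_bounding:
  fixes r :: "'a \<Rightarrow> 'c::{metric_space,second_countable_topology}"
    and W :: "'p::countable \<Rightarrow> nat \<Rightarrow> nat \<Rightarrow> 'c set"
  assumes X: "projectively_Hurewicz_space X"
    and r: "continuous_map X euclidean r"
    and opn: "\<And>p n k. open (W p n k)"
    and mono: "\<And>p n k k'. k \<le> k' \<Longrightarrow> W p n k \<subseteq> W p n k'"
    and cover: "\<And>x p n. x \<in> topspace X \<Longrightarrow> \<exists>k. r x \<in> W p n k"
  shows "\<exists>c. \<forall>x\<in>topspace X. \<forall>p. \<forall>\<^sub>F n in sequentially. r x \<in> W p n (c n)"
proof -
  define Z where "Z = top_of_set (r ` topspace X)"
  define V where "V n k = (\<Inter>q\<le>n. W (from_nat q) n k)" for n k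
  have V_open: "open (V n k)" for n k
    unfolding V_def using opn by (intro open_INT) auto
  have V_mono: "V n k \<subseteq> V n k'" if "k \<le> k'" for n k k'
    unfolding V_def using mono[OF that] by blast
  have V_cover: "\<exists>k. r x \<in> V n k" if x: "x \<in> topspace X" for x n
  proof -
    have "\<forall>q. \<exists>k. r x \<in> W (from_nat q) n k"
      using cover[OF x] by blast
    then obtain s where s: "\<And>q. r x \<in> W (from_nat q) n (s q)"
      by metis
    have "r x \<in> W (from_nat q) n (Max (s ` {..n}))" if "q \<le> n" for q
      using s[of q] mono[of "s q" "Max (s ` {..n})"] that by (meson Max_ge atMost_iff finite_atMost finite_imageI imageI subsetD)
    then show ?thesis
      unfolding V_def by auto
  qed
  have "separable_space Z"
    unfolding Z_def
    by (intro second_countable_imp_separable_space second_countable_subtopology)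
      (metis (no_types, lifting) UNIV_I open_openin second_countable_def ex_countable_basis topological_basisE topological_basis_open)
  moreover have "metrizable_space Z"
    unfolding Z_def by (intro metrizable_space_subtopology metrizable_space_euclidean)
  moreover have "continuous_map X Z r" "r ` topspace X = topspace Z"
    using r by (auto simp: Z_def continuous_map_in_subtopology)
  ultimately have Z: "Hurewicz_space Z"
    using projectively_Hurewicz_space_image[OF X] by blast
  have tZ: "topspace Z = r ` topspace X"
    by (simp add: Z_def)
  have "openin Z (topspace Z \<inter> V n k)" for n k
    using V_open unfolding tZ by (simp add: Z_def openin_open_Int)
  moreover have "(\<Union>k. topspace Z \<inter> V n k) = topspace Z" for n
    unfolding tZ using V_cover by fast
  ultimately have "\<forall>n. open_cover Z (range (\<lambda>k. topspace Z \<inter> V n k))"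
    unfolding open_cover_def by simp
  then have "\<exists>\<V>. (\<forall>n. finite (\<V> n) \<and> \<V> n \<subseteq> range (\<lambda>k. topspace Z \<inter> V n k)) \<and>
      (\<forall>z\<in>topspace Z. \<forall>\<^sub>F n in sequentially. z \<in> \<Union>(\<V> n))"
    by (intro Z[unfolded Hurewicz_space_def, rule_format]) simp
  then obtain \<V> where "\<forall>n. finite (\<V> n) \<and> \<V> n \<subseteq> range (\<lambda>k. topspace Z \<inter> V n k)"
    and "\<forall>z\<in>topspace Z. \<forall>\<^sub>F n in sequentially. z \<in> \<Union>(\<V> n)"
    by (elim exE conjE)
  then have fin: "\<And>n. finite (\<V> n)" and sub: "\<And>n. \<V> n \<subseteq> range (\<lambda>k. topspace Z \<inter> V n k)"
    and ev: "\<And>z. z \<in> topspace Z \<Longrightarrow> \<forall>\<^sub>F n in sequentially. z \<in> \<Union>(\<V> n)"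
    by simp_all
  have "\<exists>I. finite I \<and> \<V> n = (\<lambda>k. topspace Z \<inter> V n k) ` I" for n
    using finite_subset_image[OF fin[of n] sub[of n]] by (elim exE conjE) (rule exI, rule conjI)
  then obtain I where I: "\<And>n. finite (I n)" "\<And>n. \<V> n = (\<lambda>k. topspace Z \<inter> V n k) ` I n"
    by metis
  define c where "c n = Max (insert 0 (I n))" for n
  have sub_V: "\<Union>(\<V> n) \<subseteq> V n (c n)" for n
  proof -
    have "V n k \<subseteq> V n (c n)" if "k \<in> I n" for k
      using that I(1) by (intro V_mono) (auto simp: c_def)
    then show ?thesis
      unfolding I(2) by blast
  qed
  have evV: "\<forall>\<^sub>F n in sequentially. r x \<in> V n (c n)" if "x \<in> topspace X" for x
  proof -
    have "r x \<in> topspace Z"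
      using that by (simp add: tZ)
    from ev[OF this] show ?thesis
      by (rule eventually_mono) (use sub_V in blast)
  qed
  have "\<forall>\<^sub>F n in sequentially. r x \<in> W p n (c n)" if "x \<in> topspace X" for x p
    using evV[OF that] eventually_ge_at_top[of "to_nat p"]
    by eventually_elim (use from_nat_to_nat[of p] in \<open>force simp: V_def\<close>)
  then show ?thesis
    by blast
qed

section \<open>Continuity for the topology of pointwise convergence\<close>

lemma continuous_map_CpD:
  assumes T: "continuous_map (Cp Y) (Cp X) T" and g: "g \<in> topspace (Cp Y)"
    and x: "x \<in> topspace X" and "0 < \<eta>"
  obtains B \<epsilon> where "finite B" "B \<subseteq> topspace Y" "0 < \<epsilon>"
    "\<And>g'. g' \<in> topspace (Cp Y) \<Longrightarrow> (\<And>y. y \<in> B \<Longrightarrow> \<bar>g' y - g y\<bar> < \<epsilon>) \<Longrightarrow> \<bar>T g' x - T g x\<bar> < \<eta>"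
proof -
  let ?P = "product_topology (\<lambda>_. euclideanreal) (topspace Y)"
  have "continuous_map (Cp Y) (product_topology (\<lambda>_. euclideanreal) (topspace X)) T"
    using T by (simp add: Cp_def continuous_map_in_subtopology)
  then have "continuous_map (Cp Y) euclideanreal (\<lambda>g. T g x)"
    using x by (simp add: continuous_map_componentwise)
  then have "openin (Cp Y) {g' \<in> topspace (Cp Y). T g' x \<in> ball (T g x) \<eta>}"
    by (intro openin_continuous_map_preimage) auto
  then obtain U where U: "openin ?P U" 
    and eq: "{g' \<in> topspace (Cp Y). T g' x \<in> ball (T g x) \<eta>} = U \<inter> {f. continuous_map Y euclideanreal f}"
    unfolding Cp_def openin_subtopology by blast
  have "g \<in> U"
    using eq g \<open>0 < \<eta>\<close> by force
  with U have "\<exists>V. finite {i \<in> topspace Y. V i \<noteq> topspace euclideanreal} \<and>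
      (\<forall>i\<in>topspace Y. openin euclideanreal (V i)) \<and> g \<in> Pi\<^sub>E (topspace Y) V \<and> Pi\<^sub>E (topspace Y) V \<subseteq> U"
    unfolding openin_product_topology_alt by (elim bspec)
  then obtain O' where O': "finite {i \<in> topspace Y. O' i \<noteq> topspace euclideanreal}"
    "\<And>i. i \<in> topspace Y \<Longrightarrow> openin euclideanreal (O' i)" "g \<in> Pi\<^sub>E (topspace Y) O'" "Pi\<^sub>E (topspace Y) O' \<subseteq> U"
    by (elim exE conjE) (rule that, simp_all)
  define B where "B = {i \<in> topspace Y. O' i \<noteq> UNIV}"
  have fB: "finite B"
    using O'(1) by (simp add: B_def)
  have "\<exists>d>0. ball (g y) d \<subseteq> O' y" if "y \<in> B" for y
    using O'(2)[of y] O'(3) that by (auto simp: B_def PiE_iff open_contains_ball)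
  then obtain d where d: "\<And>y. y \<in> B \<Longrightarrow> 0 < d y" "\<And>y. y \<in> B \<Longrightarrow> ball (g y) (d y) \<subseteq> O' y"
    by metis
  define \<epsilon> where "\<epsilon> = Min (insert 1 (d ` B))"
  have "0 < \<epsilon>"
    unfolding \<epsilon>_def using fB d(1) by (subst Min_gr_iff) auto
  have le: "\<epsilon> \<le> d y" if "y \<in> B" for y
    unfolding \<epsilon>_def using fB that by (intro Min_le) auto
  have "\<bar>T g' x - T g x\<bar> < \<eta>"
    if g': "g' \<in> topspace (Cp Y)" and near: "\<And>y. y \<in> B \<Longrightarrow> \<bar>g' y - g y\<bar> < \<epsilon>" for g'
  proof -
    have "g' y \<in> O' y" if y: "y \<in> topspace Y" for y
    proof (cases "y \<in> B")
      case True
      then have "g' y \<in> ball (g y) (d y)"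
        using near[OF True] le[OF True] by (simp add: dist_real_def abs_minus_commute)
      then show ?thesis
        using d(2)[OF True] by blast
    qed (use y in \<open>auto simp: B_def\<close>)
    moreover have "g' \<in> extensional (topspace Y)" "continuous_map Y euclideanreal g'"
      using g' by (auto simp: Cp_def PiE_iff)
    ultimately have "g' \<in> U \<inter> {f. continuous_map Y euclideanreal f}"
      using subsetD[OF O'(4), of g'] by (simp add: PiE_iff)
    then show ?thesis
      unfolding eq[symmetric] by (simp add: dist_real_def abs_minus_commute)
  qed
  then show ?thesis
    using that[OF fB _ \<open>0 < \<epsilon>\<close>] by (auto simp: B_def)
qed

section \<open>Countable families of cutoff functions\<close>

text \<open>The family must be countable for its responses to live in a metrizable space, and it must nevertheless
  attain the values \<open>0\<close> and \<open>1\<close> exactly on arbitrary finite sets: multiplying with such a cutoff then changes a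
  function at prescribed points and leaves it unchanged at others.\<close>

definition cutoff_system :: "(nat \<Rightarrow> 'c::topological_space \<Rightarrow> real) \<Rightarrow> bool" where
  "cutoff_system D \<longleftrightarrow>
    (\<forall>l. continuous_on UNIV (D l)) \<and>
    (\<forall>l m. \<exists>j. \<forall>z. D j z = D l z * D m z) \<and>
    (\<forall>P Q. finite P \<and> finite Q \<and> P \<inter> Q = {} \<longrightarrow>
       (\<exists>l. (\<forall>z\<in>P. D l z = 1) \<and> (\<forall>z\<in>Q. D l z = 0)))"

lemma cutoff_system_continuous: "cutoff_system D \<Longrightarrow> continuous_on UNIV (D l)"
  and cutoff_system_mult: "cutoff_system D \<Longrightarrow> \<exists>j. \<forall>z. D j z = D l z * D m z"
  and cutoff_system_separates: "cutoff_system D \<Longrightarrow> finite P \<Longrightarrow> finite Q \<Longrightarrow> P \<inter> Q = {} \<Longrightarrow>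
    \<exists>l. (\<forall>z\<in>P. D l z = 1) \<and> (\<forall>z\<in>Q. D l z = 0)"
  unfolding cutoff_system_def by simp_all

text \<open>The building blocks vanish near a point of a countable dense set and equal \<open>1\<close> away from it. Finite products
  of them form the family, indexed by lists, so that products correspond to concatenation. A cutoff that is \<open>0\<close>
  on \<open>Q\<close> and \<open>1\<close> on \<open>P\<close> is a product with one factor for every point of \<open>Q\<close>.\<close>

lemma exists_cutoff_system:
  "\<exists>D :: nat \<Rightarrow> 'c::{metric_space,second_countable_topology} \<Rightarrow> real. cutoff_system D"
proof -
  obtain S :: "'c set" where S: "countable S" "\<And>U. open U \<Longrightarrow> U \<noteq> {} \<Longrightarrow> \<exists>s\<in>S. s \<in> U"
    using countable_dense_setE by blast
  define s where "s = from_nat_into S"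
  have s: "\<exists>i. dist z (s i) < \<eta>" if "0 < \<eta>" for z \<eta>
  proof -
    have "z \<in> ball z \<eta>"
      using that by simp
    then obtain a where "a \<in> S" "a \<in> ball z \<eta>"
      using S(2)[of "ball z \<eta>"] by blast
    then show ?thesis
      using S(1) unfolding s_def by (metis from_nat_into_surj mem_ball)
  qed
  define w where "w = (\<lambda>(i, j::nat) z. max 0 (min 1 (real (Suc j) * dist z (s i) - 1)))"
  define D where "D l z = prod_list (map (\<lambda>a. w a z) (from_nat l))" for l z
  have w_cont: "continuous_on UNIV (w a)" for a
    unfolding w_def by (cases a) (auto intro!: continuous_intros)
  have D_cont: "continuous_on UNIV (D l)" for l
  proof -
    have "continuous_on UNIV (\<lambda>z. prod_list (map (\<lambda>a. w a z) L))" for L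
      by (induction L) (auto intro!: continuous_intros w_cont)
    then show ?thesis
      unfolding D_def by simp
  qed
  have D_mult: "\<exists>j. \<forall>z. D j z = D l z * D m z" for l m
    by (rule exI[of _ "to_nat ((from_nat l :: (nat \<times> nat) list) @ from_nat m)"]) (simp add: D_def)
  have D_sep: "\<exists>l. (\<forall>z\<in>P. D l z = 1) \<and> (\<forall>z\<in>Q. D l z = 0)"
    if fP: "finite P" and Q: "finite Q" "P \<inter> Q = {}" for P Q
    using Q
  proof (induction Q)
    case empty
    have "D (to_nat ([] :: (nat \<times> nat) list)) z = 1" for z
      by (simp add: D_def)
    then show ?case
      by blast
  next
    case (insert q Q)
    then obtain l where l: "\<forall>z\<in>P. D l z = 1" "\<forall>z\<in>Q. D l z = 0"
      by auto
    obtain \<eta> where \<eta>: "0 < \<eta>" "\<And>z. z \<in> P \<Longrightarrow> \<eta> \<le> dist q z"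
      using finite_set_avoid[OF fP, of q] insert.prems by (metis disjoint_insert(2))
    \<comment> \<open>The factor vanishes within distance \<open>1 / Suc j\<close> of \<open>s i\<close> and is \<open>1\<close> beyond twice that distance.
      As \<open>q\<close> itself is within \<open>1 / Suc j\<close>, a gap of \<open>3 / Suc j\<close> between \<open>q\<close> and \<open>P\<close> suffices.\<close>
    obtain j :: nat where j: "3 / \<eta> < real (Suc j)"
      using reals_Archimedean2 by (metis less_trans of_nat_less_iff lessI)
    then have j3: "3 < real (Suc j) * \<eta>"
      using \<eta>(1) by (simp add: field_simps)
    obtain i where i: "dist q (s i) < 1 / real (Suc j)"
      using s[of "1 / real (Suc j)"] by auto
    then have near: "real (Suc j) * dist q (s i) < 1"
      by (simp add: field_simps)
    have "w (i, j) q = 0"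
      using near by (simp add: w_def)
    moreover have "w (i, j) z = 1" if "z \<in> P" for z
    proof -
      have "\<eta> \<le> dist q (s i) + dist z (s i)"
        using \<eta>(2)[OF that] dist_triangle2[of q z "s i"] by linarith
      then have "real (Suc j) * \<eta> \<le> real (Suc j) * dist q (s i) + real (Suc j) * dist z (s i)"
        by (metis distrib_left mult_left_mono of_nat_0_le_iff)
      then have "2 < real (Suc j) * dist z (s i)"
        using j3 near by linarith
      then show ?thesis
        by (simp add: w_def)
    qed
    ultimately show ?case
      using l by (intro exI[of _ "to_nat ((i, j) # from_nat l)"]) (auto simp: D_def)
  qed
  show ?thesis
    unfolding cutoff_system_def
    by (intro exI[of _ D] conjI allI impI) (use D_cont D_mult D_sep in simp_all)
qed

section \<open>Supports\<close>

text \<open>A nonlinear substitute for the support of a functional: \<open>t\<close> plays the role of the values of a functional on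
  the family \<open>D\<close>, and the entries \<open>b i\<close> with \<open>i \<in> M\<close> are points that control it near zero. Tuples are indexed
  by all of \<open>nat\<close> and the relevant positions are singled out by \<open>M\<close>; thus all tuples form one compact space,
  and a tuple is shortened by shrinking \<open>M\<close>, without renumbering.\<close>

definition supports ::
  "(nat \<Rightarrow> 'c \<Rightarrow> real) \<Rightarrow> real \<Rightarrow> real \<Rightarrow> nat set \<Rightarrow> (nat \<Rightarrow> real) \<Rightarrow> (nat \<Rightarrow> 'c) \<Rightarrow> bool" where
  "supports D \<epsilon> \<delta> M t b \<longleftrightarrow> (\<forall>l. (\<forall>i\<in>M. \<bar>D l (b i)\<bar> < \<epsilon>) \<longrightarrow> \<bar>t l\<bar> \<le> \<delta>)"

definition supported ::
  "(nat \<Rightarrow> 'c \<Rightarrow> real) \<Rightarrow> 'c set \<Rightarrow> real \<Rightarrow> real \<Rightarrow> nat set \<Rightarrow> (nat \<Rightarrow> real) set" where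
  "supported D K \<epsilon> \<delta> M = {t. \<exists>b\<in>UNIV \<rightarrow> K. supports D \<epsilon> \<delta> M t b}"

lemma supports_iff:
  "supports D \<epsilon> \<delta> M t b \<longleftrightarrow> (\<forall>l. (\<exists>i\<in>M. \<epsilon> \<le> \<bar>D l (b i)\<bar>) \<or> \<bar>t l\<bar> \<le> \<delta>)"
  unfolding supports_def not_less[symmetric] by blast

lemma supports_mono:
  "supports D \<epsilon> \<delta> M t b \<Longrightarrow> M \<subseteq> M' \<Longrightarrow> supports D \<epsilon> \<delta> M' t b"
  unfolding supports_def by blast

lemma closed_supports:
  fixes D :: "nat \<Rightarrow> 'c::topological_space \<Rightarrow> real"
  assumes D: "\<And>l. continuous_on UNIV (D l)" and "finite M"
  shows "closed {(t, b). supports D \<epsilon> \<delta> M t b}"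
proof -
  have eq: "{(t, b). supports D \<epsilon> \<delta> M t b} =
      (\<Inter>l. (\<Union>i\<in>M. {p. \<epsilon> \<le> \<bar>D l (snd p i)\<bar>}) \<union> {p. \<bar>fst p l\<bar> \<le> \<delta>})"
    by (simp add: set_eq_iff supports_iff)
  have snd: "continuous_on UNIV (\<lambda>p :: (nat \<Rightarrow> real) \<times> (nat \<Rightarrow> 'c). D l (snd p i))" for l i
  proof -
    have "continuous_on UNIV (\<lambda>p :: (nat \<Rightarrow> real) \<times> (nat \<Rightarrow> 'c). snd p i)"
      by (rule continuous_on_product_then_coordinatewise) (intro continuous_intros)
    then show ?thesis
      using continuous_on_compose2[OF D] by blast
  qed
  have fst: "continuous_on UNIV (\<lambda>p :: (nat \<Rightarrow> real) \<times> (nat \<Rightarrow> 'c). fst p l)" for l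
    by (rule continuous_on_product_then_coordinatewise) (intro continuous_intros)
  have "closed {p :: (nat \<Rightarrow> real) \<times> (nat \<Rightarrow> 'c). \<epsilon> \<le> \<bar>D l (snd p i)\<bar>}" for l i
    by (rule closed_Collect_le[OF continuous_on_const continuous_on_rabs[OF snd]])
  moreover have "closed {p :: (nat \<Rightarrow> real) \<times> (nat \<Rightarrow> 'c). \<bar>fst p l\<bar> \<le> \<delta>}" for l
    by (rule closed_Collect_le[OF continuous_on_rabs[OF fst] continuous_on_const])
  ultimately show ?thesis
    unfolding eq using \<open>finite M\<close> by (intro closed_INT ballI closed_Un closed_UN)
qed

text \<open>Compactness of the set of tuples, which may leave the image of \<open>Y\<close>, is what makes this set closed.\<close>

lemma closed_supported:
  fixes D :: "nat \<Rightarrow> 'c::topological_space \<Rightarrow> real"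
  assumes "\<And>l. continuous_on UNIV (D l)" and "finite M" and "compact K"
  shows "closed (supported D K \<epsilon> \<delta> M)"
  using closed_projection_along_compact[OF closed_supports[OF assms(1,2)] compact_Pi_UNIV[OF assms(3)]]
  unfolding supported_def mem_Collect_eq prod.case .

text \<open>This is the upper semicontinuity of supports: if all supports of \<open>t\<close> have their entries in \<open>G\<close>, then so do
  all supports of nearby points.\<close>

lemma closed_supported_by_points_outside:
  fixes D :: "nat \<Rightarrow> 'c::topological_space \<Rightarrow> real"
  assumes D: "\<And>l. continuous_on UNIV (D l)" and M: "finite M" and K: "compact K" and G: "open G"
  shows "closed {t. \<exists>b\<in>UNIV \<rightarrow> K. supports D \<epsilon> \<delta> M t b \<and> (\<exists>i\<in>M. b i \<notin> G)}"
proof -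
  have "closed (\<Union>i\<in>M. {p :: (nat \<Rightarrow> real) \<times> (nat \<Rightarrow> 'c). snd p i \<in> - G})"
  proof (intro closed_UN M ballI)
    fix i
    have "continuous_on UNIV (\<lambda>p :: (nat \<Rightarrow> real) \<times> (nat \<Rightarrow> 'c). snd p i)"
      by (rule continuous_on_product_then_coordinatewise) (intro continuous_intros)
    then show "closed {p :: (nat \<Rightarrow> real) \<times> (nat \<Rightarrow> 'c). snd p i \<in> - G}"
      using continuous_closed_preimage[OF _ closed_UNIV, of _ "- G"] G
      by (simp add: vimage_def closed_Compl)
  qed
  then have "closed ({(t, b). supports D \<epsilon> \<delta> M t b} \<inter> (\<Union>i\<in>M. {p. snd p i \<in> - G}))"
    by (intro closed_Int closed_supports D M)
  from closed_projection_along_compact[OF this compact_Pi_UNIV[OF K]] show ?thesis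
    by (simp only: mem_Collect_eq prod.case Int_iff UN_iff snd_conv Compl_iff)
qed

lemma exists_minimal_subset:
  assumes "finite A" and "P A"
  shows "\<exists>M\<subseteq>A. P M \<and> (\<forall>N. N \<subset> M \<longrightarrow> \<not> P N)"
  using assms
proof (induction A rule: finite_psubset_induct)
  case (psubset A)
  then show ?case
    by (cases "\<exists>N. N \<subset> A \<and> P N") (meson order.trans psubset_imp_subset order.refl)+
qed

section \<open>Supports of points under a continuous map of function spaces\<close>

text \<open>The restriction to the carrier makes \<open>u \<circ> e\<close> an element of the function space, whose elements are
  \<open>undefined\<close> elsewhere.\<close>

definition pull :: "'b topology \<Rightarrow> ('b \<Rightarrow> 'c) \<Rightarrow> ('c \<Rightarrow> real) \<Rightarrow> 'b \<Rightarrow> real" where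
  "pull Y e u = (\<lambda>y\<in>topspace Y. u (e y))"

lemma pull_in_Cp:
  fixes e :: "'b \<Rightarrow> 'c::topological_space"
  assumes "continuous_map Y euclidean e" "continuous_on UNIV u"
  shows "pull Y e u \<in> topspace (Cp Y)"
proof -
  have "continuous_map Y euclideanreal (u \<circ> e)"
    using assms by (metis continuous_map_compose continuous_map_iff_continuous subtopology_UNIV)
  then have "continuous_map Y euclideanreal (pull Y e u)"
    by (rule continuous_map_eq) (simp add: pull_def)
  then show ?thesis
    by (simp add: Cp_def pull_def)
qed

text \<open>Subtracting the value at the zero function normalizes \<open>T\<close>, which need not preserve zero.\<close>

definition response ::
  "'b topology \<Rightarrow> ('b \<Rightarrow> 'c) \<Rightarrow> (('b \<Rightarrow> real) \<Rightarrow> 'a \<Rightarrow> real) \<Rightarrow> (nat \<Rightarrow> 'c \<Rightarrow> real) \<Rightarrow> 'a \<Rightarrow> nat \<Rightarrow> real"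
  where "response Y e T D x = (\<lambda>l. T (pull Y e (D l)) x - T (pull Y e (\<lambda>_. 0)) x)"

lemma continuous_map_response:
  fixes e :: "'b \<Rightarrow> 'c::topological_space"
  assumes T: "continuous_map (Cp Y) (Cp X) T" and e: "continuous_map Y euclidean e"
    and D: "cutoff_system D"
  shows "continuous_map X euclidean (response Y e T D)"
proof -
  have "continuous_map X euclideanreal (T g)" if "g \<in> topspace (Cp Y)" for g
  proof -
    have "T g \<in> topspace (Cp X)"
      using continuous_map_image_subset_topspace[OF T] that by blast
    then show ?thesis
      by (simp add: Cp_def)
  qed
  then have "continuous_map X euclideanreal (\<lambda>x. response Y e T D x l)" for l
    using pull_in_Cp[OF e cutoff_system_continuous[OF D]] pull_in_Cp[OF e continuous_on_const]
    unfolding response_def by (intro continuous_map_diff) simp_all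
  then show ?thesis
    by (subst euclidean_product_topology[symmetric]) (simp add: continuous_map_componentwise_UNIV)
qed

text \<open>Entries outside the image of \<open>Y\<close> are superfluous. Suppose \<open>D l\<close> is small at the remaining entries but has
  a large response at \<open>x\<close>. The response is almost determined by the values of \<open>D l \<circ> e\<close> on a finite \<open>B \<subseteq> Y\<close>,
  and \<open>e(B)\<close> avoids the discarded entries. So \<open>D l\<close> can be multiplied with a cutoff that is \<open>1\<close> on \<open>e(B)\<close> and
  the remaining entries and \<open>0\<close> at the discarded ones. The product is small on the whole tuple, and its
  response is still large, contradicting that the tuple is a support.\<close>

lemma supports_response_restrict:
  fixes e :: "'b \<Rightarrow> 'c::topological_space"
  assumes T: "continuous_map (Cp Y) (Cp X) T" and e: "continuous_map Y euclidean e"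
    and D: "cutoff_system D" and x: "x \<in> topspace X" and M: "finite M"
    and b: "supports D \<epsilon> \<delta> M (response Y e T D x) b" and "0 < \<epsilon>"
  shows "supports D \<epsilon> \<delta> {i\<in>M. b i \<in> e ` topspace Y} (response Y e T D x) b"
  unfolding supports_def
proof (intro allI impI, rule ccontr)
  fix l
  let ?M = "{i\<in>M. b i \<in> e ` topspace Y}" and ?r = "response Y e T D x"
  assume small: "\<forall>i\<in>?M. \<bar>D l (b i)\<bar> < \<epsilon>" and "\<not> \<bar>?r l\<bar> \<le> \<delta>"
  then have pos: "0 < \<bar>?r l\<bar> - \<delta>"
    by simp
  have in_Cp: "pull Y e (D j) \<in> topspace (Cp Y)" for j
    using cutoff_system_continuous[OF D] by (intro pull_in_Cp e)
  obtain B \<gamma> where B: "finite B" "B \<subseteq> topspace Y" "0 < \<gamma>"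
    and near: "\<And>g'. g' \<in> topspace (Cp Y) \<Longrightarrow> (\<And>y. y \<in> B \<Longrightarrow> \<bar>g' y - pull Y e (D l) y\<bar> < \<gamma>) \<Longrightarrow>
      \<bar>T g' x - T (pull Y e (D l)) x\<bar> < \<bar>?r l\<bar> - \<delta>"
    by (rule continuous_map_CpD[OF T in_Cp[of l] x pos]) blast
  define P where "P = e ` B \<union> b ` ?M"
  define Q where "Q = b ` (M - ?M)"
  have "finite P" "finite Q" "P \<inter> Q = {}"
    using B M by (auto simp: P_def Q_def)
  then have "\<exists>m. (\<forall>z\<in>P. D m z = 1) \<and> (\<forall>z\<in>Q. D m z = 0)"
    by (rule cutoff_system_separates[OF D])
  then obtain m where m1: "\<And>z. z \<in> P \<Longrightarrow> D m z = 1" and m0: "\<And>z. z \<in> Q \<Longrightarrow> D m z = 0"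
    by auto
  obtain j where j: "\<And>z. D j z = D l z * D m z"
    using cutoff_system_mult[OF D] by metis
  have "\<bar>D j (b i)\<bar> < \<epsilon>" if "i \<in> M" for i
  proof (cases "i \<in> ?M")
    case True
    then show ?thesis
      using small m1[of "b i"] by (simp add: j P_def)
  next
    case False
    then have "b i \<in> Q"
      using that by (simp add: Q_def)
    then show ?thesis
      using m0 \<open>0 < \<epsilon>\<close> by (simp add: j)
  qed
  then have "\<bar>?r j\<bar> \<le> \<delta>"
    using b by (auto simp: supports_def)
  moreover have "\<bar>?r j - ?r l\<bar> < \<bar>?r l\<bar> - \<delta>"
  proof -
    have "\<bar>pull Y e (D j) y - pull Y e (D l) y\<bar> < \<gamma>" if "y \<in> B" for y
      using that B m1[of "e y"] by (auto simp: pull_def j P_def)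
    from near[OF in_Cp this] show ?thesis
      by (simp add: response_def)
  qed
  ultimately show False
    by linarith
qed

section \<open>Transfer of bounding sequences\<close>

text \<open>The bounding property passes from \<open>X\<close> to \<open>Y\<close> along a continuous map of function spaces with continuous left
  inverse. Continuity of \<open>T\<close> provides the finite supports in \<open>e(Y)\<close> of the points of \<open>X\<close>, and continuity of
  \<open>T'\<close> shows that these supports exhaust \<open>e(Y)\<close>.\<close>

lemma bounding_transfer:
  fixes e :: "'b \<Rightarrow> 'c::{metric_space,second_countable_topology}"
    and G :: "nat \<Rightarrow> nat \<Rightarrow> 'c set"
  assumes X: "projectively_Hurewicz_space X"
    and T: "continuous_map (Cp Y) (Cp X) T" and T': "continuous_map (Cp X) (Cp Y) T'"
    and inv: "\<And>g. g \<in> topspace (Cp Y) \<Longrightarrow> T' (T g) = g"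
    and e: "continuous_map Y euclidean e" and K: "compact K" and eK: "e ` topspace Y \<subseteq> K"
    and G_open: "\<And>n k. open (G n k)"
    and G_mono: "\<And>n k k'. k \<le> k' \<Longrightarrow> G n k \<subseteq> G n k'"
    and G_cover: "\<And>y n. y \<in> topspace Y \<Longrightarrow> \<exists>k. e y \<in> G n k"
  shows "\<exists>c. \<forall>y\<in>topspace Y. \<forall>\<^sub>F n in sequentially. e y \<in> G n (c n)"
proof -
  obtain D :: "nat \<Rightarrow> 'c \<Rightarrow> real" where D: "cutoff_system D"
    using exists_cutoff_system by blast
  note D_cont = cutoff_system_continuous[OF D]
  define r where "r = response Y e T D"
  define C where "C M j d = supported D K (1 / real (Suc j)) (1 / real (Suc d)) M" for M j d
  define S where "S M j d t = {b \<in> UNIV \<rightarrow> K. supports D (1 / real (Suc j)) (1 / real (Suc d)) M t b}" for M j d t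
  \<comment> \<open>The points outside the closed set of those with a support on fewer positions form an open set, here
    exhausted by the closed sets \<open>far M l j d\<close> for \<open>l = 0, 1, \<dots>\<close>. For \<open>r x\<close> in
    one of them, all supports on \<open>M\<close> have their entries in \<open>e(Y)\<close>.\<close>
  define far where "far M l j d = {t. \<forall>i\<in>M. \<forall>c\<in>C (M - {i}) j d. 1 / real (Suc l) \<le> dist t c}" for M l j d
  define bad where "bad M j d U = {t. \<exists>b\<in>S M j d t. \<exists>i\<in>M. b i \<notin> U}" for M j d U
  \<comment> \<open>A cover must also contain the points for which the parameters say nothing, so the condition that \<open>G n k\<close>
    contains all entries is imposed on \<open>far\<close> only. Lists encode the finite sets \<open>M\<close> by a countable type.\<close>
  define W where "W = (\<lambda>(xs, l, j, d) n k. - (far (set xs) l j d \<inter> bad (set xs) j d (G n k)))"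
  have C_eq: "t \<in> C M j d \<longleftrightarrow> S M j d t \<noteq> {}" for t M j d
    by (auto simp: C_def S_def supported_def)
  have far_closed: "closed (far M l j d)" for M l j d
  proof -
    have "far M l j d = (\<Inter>i\<in>M. \<Inter>c\<in>C (M - {i}) j d. {t. 1 / real (Suc l) \<le> dist t c})"
      by (auto simp: far_def)
    then show ?thesis
      by (auto intro!: closed_INT closed_Collect_le continuous_intros)
  qed
  have bad_closed: "closed (bad M j d (G n k))" if "finite M" for M j d n k
  proof -
    have "bad M j d (G n k) = {t. \<exists>b\<in>UNIV \<rightarrow> K.
        supports D (1 / real (Suc j)) (1 / real (Suc d)) M t b \<and> (\<exists>i\<in>M. b i \<notin> G n k)}"
      by (auto simp: bad_def S_def)
    then show ?thesis
      using closed_supported_by_points_outside[OF D_cont that K G_open] by simp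
  qed
  have W_open: "open (W p n k)" for p n k
    unfolding W_def by (cases p) (auto intro!: open_Compl closed_Int far_closed bad_closed)
  have W_mono: "W p n k \<subseteq> W p n k'" if "k \<le> k'" for p n k k'
    using G_mono[OF that, of n] unfolding W_def by (cases p) (auto simp: bad_def)
  have S_compact: "compact (S M j d t)" if "finite M" for M j d t
  proof -
    have "closed (Pair t -` {(t, b). supports D (1 / real (Suc j)) (1 / real (Suc d)) M t b})"
      by (intro closed_vimage closed_supports D_cont that continuous_intros)
    then have "closed {b. supports D (1 / real (Suc j)) (1 / real (Suc d)) M t b}"
      by (simp add: vimage_def)
    moreover have "S M j d t = (UNIV \<rightarrow> K) \<inter> {b. supports D (1 / real (Suc j)) (1 / real (Suc d)) M t b}"
      by (auto simp: S_def)
    ultimately show ?thesis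
      by (simp add: compact_Int_closed compact_Pi_UNIV K)
  qed
  have W_cover: "\<exists>k. r x \<in> W p n k" if x: "x \<in> topspace X" for x p n
  proof -
    obtain xs l j d where p: "p = (xs, l, j, d)"
      by (cases p rule: prod_cases4)
    define M where "M = set xs"
    have fM: "finite M"
      by (simp add: M_def)
    show ?thesis
    proof (cases "r x \<in> far M l j d")
      case False
      then show ?thesis
        by (simp add: W_def p M_def)
    next
      case True
      define V where "V = (\<Union>i\<in>M. (\<lambda>b. b i) ` S M j d (r x))"
      have "compact V"
        unfolding V_def
      proof (intro compact_UN fM)
        fix i
        have "continuous_on (S M j d (r x)) (\<lambda>b. b i)"
          by (rule continuous_on_product_then_coordinatewise[OF continuous_on_id])
        then show "compact ((\<lambda>b. b i) ` S M j d (r x))"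
          by (rule compact_continuous_image[OF _ S_compact[OF fM]])
      qed
      have "V \<subseteq> e ` topspace Y"
      proof
        fix z
        assume "z \<in> V"
        then obtain i b where i: "i \<in> M" and z: "z = b i" and b: "b \<in> S M j d (r x)"
          by (auto simp: V_def)
        show "z \<in> e ` topspace Y"
        proof (rule ccontr)
          assume out: "z \<notin> e ` topspace Y"
          have "supports D (1 / real (Suc j)) (1 / real (Suc d)) {i \<in> M. b i \<in> e ` topspace Y} (r x) b"
            unfolding r_def using b
            by (intro supports_response_restrict[OF T e D x fM]) (auto simp: S_def r_def)
          then have "supports D (1 / real (Suc j)) (1 / real (Suc d)) (M - {i}) (r x) b"
            by (rule supports_mono) (use out z in auto)
          then have "r x \<in> C (M - {i}) j d"
            using b by (auto simp: C_eq S_def)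
          then have "1 / real (Suc l) \<le> dist (r x) (r x)"
            using True i unfolding far_def by blast
          then show False
            by simp
        qed
      qed
      moreover have "e ` topspace Y \<subseteq> (\<Union>k\<in>UNIV. G n k)"
        using G_cover[of _ n] by (simp add: image_subset_iff)
      ultimately have "V \<subseteq> (\<Union>k\<in>UNIV. G n k)"
        by (rule subset_trans)
      then obtain I where I: "finite I" "V \<subseteq> (\<Union>k\<in>I. G n k)"
        by (rule compactE_image[OF \<open>compact V\<close> G_open])
      have "G n k \<subseteq> G n (Max (insert 0 I))" if "k \<in> I" for k
        using that I(1) by (intro G_mono) simp
      then have "V \<subseteq> G n (Max (insert 0 I))"
        using I(2) by blast
      then have "r x \<notin> bad M j d (G n (Max (insert 0 I)))"
        by (auto simp: bad_def V_def)
      then show ?thesis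
        by (intro exI[of _ "Max (insert 0 I)"]) (simp add: W_def p M_def)
    qed
  qed
  have "\<exists>c. \<forall>x\<in>topspace X. \<forall>p. \<forall>\<^sub>F n in sequentially. r x \<in> W p n (c n)"
    using continuous_map_response[OF T e D] W_open W_mono W_cover
    by (intro projectively_Hurewicz_bounding[OF X]) (simp_all add: r_def)
  then obtain c where c: "\<And>x p. x \<in> topspace X \<Longrightarrow> \<forall>\<^sub>F n in sequentially. r x \<in> W p n (c n)"
    by blast
  have "\<forall>\<^sub>F n in sequentially. e y \<in> G n (c n)" if y: "y \<in> topspace Y" for y
  proof -
    define g0 where "g0 = pull Y e (\<lambda>_. 0 :: real)"
    have g0: "g0 \<in> topspace (Cp Y)"
      unfolding g0_def by (intro pull_in_Cp e) simp
    have gl: "pull Y e (D l) \<in> topspace (Cp Y)" for l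
      by (intro pull_in_Cp e D_cont)
    have T_in: "T g \<in> topspace (Cp X)" if "g \<in> topspace (Cp Y)" for g
      using continuous_map_image_subset_topspace[OF T] that by blast
    obtain A \<delta> where A: "finite A" "A \<subseteq> topspace X" "0 < \<delta>"
      and A_near: "\<And>f. f \<in> topspace (Cp X) \<Longrightarrow> (\<And>x. x \<in> A \<Longrightarrow> \<bar>f x - T g0 x\<bar> < \<delta>) \<Longrightarrow>
        \<bar>T' f y - T' (T g0) y\<bar> < 1"
      using continuous_map_CpD[OF T' T_in[OF g0] y, of 1] by auto
    obtain d where d: "1 / real (Suc d) < \<delta>"
      using A(3) nat_approx_posE by blast
    have "\<exists>xs l j. S (set xs) j d (r x) \<noteq> {} \<and> r x \<in> far (set xs) l j d" if x: "x \<in> A" for x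
    proof -
      obtain B \<epsilon> where B: "finite B" "B \<subseteq> topspace Y" "0 < \<epsilon>"
        and B_near: "\<And>g. g \<in> topspace (Cp Y) \<Longrightarrow> (\<And>y. y \<in> B \<Longrightarrow> \<bar>g y - g0 y\<bar> < \<epsilon>) \<Longrightarrow>
          \<bar>T g x - T g0 x\<bar> < 1 / real (Suc d)"
      proof -
        have "x \<in> topspace X" "0 < 1 / real (Suc d)"
          using x A(2) by auto
        from continuous_map_CpD[OF T g0 this] show ?thesis
          using that by blast
      qed
      obtain j where j: "1 / real (Suc j) < \<epsilon>"
        using B(3) nat_approx_posE by blast
      \<comment> \<open>The set \<open>B\<close> is written as a tuple; the positions from \<open>N\<close> on are filled with \<open>e y\<close> merely to stay
        in \<open>K\<close>.\<close>
      obtain N and h :: "nat \<Rightarrow> 'b" where h: "B = h ` {i. i < (N::nat)}"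
        using finite_imp_nat_seg_image_inj_on[OF B(1)] by blast
      define b where "b i = (if i < N then e (h i) else e y)" for i
      have "b \<in> UNIV \<rightarrow> K"
        using eK y B(2) by (simp add: b_def h image_subset_iff)
      moreover have "supports D (1 / real (Suc j)) (1 / real (Suc d)) {..<N} (r x) b"
        unfolding supports_def
      proof (intro allI impI)
        fix l
        assume small: "\<forall>i\<in>{..<N}. \<bar>D l (b i)\<bar> < 1 / real (Suc j)"
        have "\<bar>D l (e (h i))\<bar> < \<epsilon>" if "i < N" for i
        proof -
          have "\<bar>D l (b i)\<bar> < \<epsilon>"
            using small that j by (meson lessThan_iff less_trans)
          then show ?thesis
            using that by (simp add: b_def)
        qed
        then have "\<bar>pull Y e (D l) y' - g0 y'\<bar> < \<epsilon>" if "y' \<in> B" for y'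
          using that B(2) by (auto simp: pull_def g0_def h image_subset_iff)
        from B_near[OF gl this] show "\<bar>r x l\<bar> \<le> 1 / real (Suc d)"
          by (simp add: r_def response_def g0_def)
      qed
      ultimately have "S {..<N} j d (r x) \<noteq> {}"
        by (auto simp: S_def)
      then have "\<exists>M\<subseteq>{..<N}. S M j d (r x) \<noteq> {} \<and> (\<forall>M'. M' \<subset> M \<longrightarrow> \<not> S M' j d (r x) \<noteq> {})"
        by (intro exists_minimal_subset) simp_all
      then obtain M where M: "M \<subseteq> {..<N}" "S M j d (r x) \<noteq> {}"
        and M_min: "\<And>M'. M' \<subset> M \<Longrightarrow> S M' j d (r x) = {}"
        by auto
      have fM: "finite M"
        using M(1) finite_subset by blast
      define F where "F = (\<Union>i\<in>M. C (M - {i}) j d)"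
      have "closed F"
        unfolding F_def C_def by (intro closed_UN fM ballI closed_supported D_cont K finite_Diff)
      moreover have "r x \<notin> F"
      proof -
        have "S (M - {i}) j d (r x) = {}" if "i \<in> M" for i
          using that by (intro M_min) blast
        then show ?thesis
          by (simp add: F_def C_eq)
      qed
      ultimately obtain \<eta> where \<eta>: "0 < \<eta>" "ball (r x) \<eta> \<subseteq> - F"
        by (meson ComplI closed_def open_contains_ball)
      obtain l where l: "1 / real (Suc l) < \<eta>"
        using \<eta>(1) nat_approx_posE by blast
      have "r x \<in> far M l j d"
        unfolding far_def
      proof (intro CollectI ballI)
        fix i t
        assume "i \<in> M" "t \<in> C (M - {i}) j d"
        then have "t \<notin> ball (r x) \<eta>"
          using \<eta>(2) unfolding F_def by blast
        then show "1 / real (Suc l) \<le> dist (r x) t"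
          using l by (simp add: not_less)
      qed
      then show ?thesis
        using M(2) finite_list[OF fM] by blast
    qed
    then obtain xs l j where xs: "\<And>x. x \<in> A \<Longrightarrow> S (set (xs x)) (j x) d (r x) \<noteq> {}"
      and fr: "\<And>x. x \<in> A \<Longrightarrow> r x \<in> far (set (xs x)) (l x) (j x) d"
      by metis
    have "\<forall>\<^sub>F n in sequentially. \<forall>x\<in>A. r x \<in> W (xs x, l x, j x, d) n (c n)"
      using A c by (intro eventually_ball_finite) auto
    then show ?thesis
    proof (rule eventually_mono)
      fix n
      assume W: "\<forall>x\<in>A. r x \<in> W (xs x, l x, j x, d) n (c n)"
      define b where "b x = (SOME b. b \<in> S (set (xs x)) (j x) d (r x))" for x
      have b: "b x \<in> S (set (xs x)) (j x) d (r x)" if "x \<in> A" for x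
        unfolding b_def using xs[OF that] by (rule some_in_eq[THEN iffD2])
      have bG: "b x i \<in> G n (c n)" if "x \<in> A" "i \<in> set (xs x)" for x i
        using W fr[OF that(1)] b[OF that(1)] that by (auto simp: W_def bad_def)
      show "e y \<in> G n (c n)"
      proof (rule ccontr)
        assume "e y \<notin> G n (c n)"
        then have "{e y} \<inter> (\<Union>x\<in>A. b x ` set (xs x)) = {}"
          using bG by auto
        then have "\<exists>m. (\<forall>z\<in>{e y}. D m z = 1) \<and> (\<forall>z\<in>(\<Union>x\<in>A. b x ` set (xs x)). D m z = 0)"
          using A(1) by (intro cutoff_system_separates[OF D]) auto
        then obtain m where m1: "D m (e y) = 1" and m0: "\<And>x i. x \<in> A \<Longrightarrow> i \<in> set (xs x) \<Longrightarrow> D m (b x i) = 0"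
          by auto
        have small: "\<bar>r x m\<bar> \<le> 1 / real (Suc d)" if "x \<in> A" for x
          using b[OF that] m0[OF that] by (auto simp: S_def supports_def)
        have "\<bar>T (pull Y e (D m)) x - T g0 x\<bar> < \<delta>" if "x \<in> A" for x
          using le_less_trans[OF small[OF that] d] by (simp add: r_def response_def g0_def)
        from A_near[OF T_in[OF gl] this] show False
          using m1 y by (simp add: inv gl g0) (simp add: pull_def g0_def)
      qed
    qed
  qed
  then show ?thesis
    by blast
qed

section \<open>Reduction to the cube\<close>

text \<open>Bumps around the points of a dense sequence with radii \<open>1 / Suc j\<close>: their positivity sets form a base, and as
  coordinates they map the space continuously into a cube in which every base set becomes the preimage of an
  open set.\<close>

lemma separable_metrizable_cozero_base:
  assumes "metrizable_space Z" and "separable_space Z"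
  obtains \<phi> :: "nat \<Rightarrow> 'z \<Rightarrow> real"
  where "\<And>i. continuous_map Z euclideanreal (\<phi> i)" "\<And>i z. z \<in> topspace Z \<Longrightarrow> \<phi> i z \<in> {0..1}"
    "\<And>U z. openin Z U \<Longrightarrow> z \<in> U \<Longrightarrow> \<exists>i. 0 < \<phi> i z \<and> {w \<in> topspace Z. 0 < \<phi> i w} \<subseteq> U"
proof (cases "topspace Z = {}")
  case True
  show ?thesis
    by (rule that[of "\<lambda>_ _. 0"]) (use True in \<open>auto dest: openin_subset\<close>)
next
  case False
  obtain M d where "Metric_space M d" and Z: "Z = Metric_space.mtopology M d"
    using assms(1) unfolding metrizable_space_def by blast
  then interpret Metric_space M d
    by simp
  obtain Q where Q: "countable Q" "Q \<subseteq> M" "mtopology closure_of Q = M"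
    using assms(2) unfolding separable_space_def Z by auto
  have "Q \<noteq> {}"
    using Q(3) False Z by auto
  define q where "q = from_nat_into Q"
  have q_M: "q i \<in> M" for i
    using Q(2) from_nat_into[OF \<open>Q \<noteq> {}\<close>, of i] by (auto simp: q_def)
  have q_dense: "\<exists>i. d (q i) z < \<eta>" if z: "z \<in> M" and \<eta>: "0 < \<eta>" for z \<eta>
  proof -
    have "z \<in> mtopology closure_of Q"
      using Q(3) z by simp
    then obtain a where "a \<in> Q" "a \<in> mball z \<eta>"
      using \<eta> unfolding metric_closure_of by blast
    then show ?thesis
      using from_nat_into_surj[OF Q(1)] unfolding q_def by (metis commute in_mball)
  qed
  define \<psi> where "\<psi> i j z = max 0 (1 - real (Suc j) * d (q i) z)" for i j z
  define \<phi> where "\<phi> n = (case prod_decode n of (i, j) \<Rightarrow> \<psi> i j)" for n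
  have \<psi>_pos: "0 < \<psi> i j z \<longleftrightarrow> d (q i) z < 1 / real (Suc j)" for i j z
    by (simp add: \<psi>_def less_max_iff_disj field_simps)
  have d_cont: "continuous_map mtopology euclideanreal (\<lambda>z. d (q i) z)" for i
  proof -
    have "continuous_map (mtopology_of (metric (M, d))) euclideanreal (\<lambda>z. mdist (metric (M, d)) (q i) z)"
      by (intro continuous_map_mdist) (auto simp: q_M)
    then show ?thesis
      by simp
  qed
  have \<psi>_cont: "continuous_map Z euclideanreal (\<psi> i j)" for i j
    unfolding \<psi>_def Z
    by (intro continuous_map_real_max continuous_map_diff continuous_map_real_mult_left d_cont) auto
  show ?thesis
  proof (rule that[of \<phi>])
    show "continuous_map Z euclideanreal (\<phi> n)" for n
      unfolding \<phi>_def using \<psi>_cont by (auto split: prod.split)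
    show "\<phi> n z \<in> {0..1}" for n z
      by (auto simp: \<phi>_def \<psi>_def split: prod.split)
  next
    fix U z
    assume U: "openin Z U" "z \<in> U"
    then obtain \<epsilon> where \<epsilon>: "0 < \<epsilon>" "mball z \<epsilon> \<subseteq> U" and z: "z \<in> M"
      unfolding Z openin_mtopology by blast
    obtain j where j: "1 / real (Suc j) < \<epsilon> / 2"
      using \<epsilon>(1) nat_approx_posE[of "\<epsilon> / 2"] by auto
    obtain i where i: "d (q i) z < 1 / real (Suc j)"
      using q_dense[OF z, of "1 / real (Suc j)"] by auto
    have "w \<in> U" if w: "w \<in> M" "d (q i) w < 1 / real (Suc j)" for w
    proof -
      have "d z w \<le> d (q i) z + d (q i) w"
        using triangle[OF z q_M w(1), of i] by (simp add: commute)
      then have "d z w < \<epsilon>"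
        using i w(2) j by linarith
      then show ?thesis
        using \<epsilon>(2) z w(1) by auto
    qed
    then show "\<exists>n. 0 < \<phi> n z \<and> {w \<in> topspace Z. 0 < \<phi> n w} \<subseteq> U"
      using i by (intro exI[of _ "prod_encode (i, j)"]) (auto simp: \<phi>_def \<psi>_pos Z)
  qed
qed

text \<open>In the coordinates of the previous lemma, \<open>G n k\<close> is the union of those among the first base sets that are
  contained in a member of the \<open>n\<close>-th cover; one such member for each of them gives the finite subfamily.\<close>

lemma projectively_Hurewicz_space_transfer:
  fixes X :: "'a topology" and Y :: "'b topology"
  assumes X: "projectively_Hurewicz_space X"
    and T: "continuous_map (Cp Y) (Cp X) T" and T': "continuous_map (Cp X) (Cp Y) T'"
    and inv: "\<And>g. g \<in> topspace (Cp Y) \<Longrightarrow> T' (T g) = g"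
  shows "projectively_Hurewicz_space Y"
  unfolding projectively_Hurewicz_space_def
proof (intro allI impI)
  fix Z :: "'b topology" and f
  assume "continuous_map Y Z f \<and> f ` topspace Y = topspace Z \<and> separable_space Z \<and> metrizable_space Z"
  then have f: "continuous_map Y Z f" and surj: "f ` topspace Y = topspace Z"
    and Z: "metrizable_space Z" "separable_space Z"
    by auto
  obtain \<phi> :: "nat \<Rightarrow> 'b \<Rightarrow> real" where \<phi>_cont: "\<And>i. continuous_map Z euclideanreal (\<phi> i)"
    and \<phi>_range: "\<And>i z. z \<in> topspace Z \<Longrightarrow> \<phi> i z \<in> {0..1}"
    and \<phi>_base: "\<And>U z. openin Z U \<Longrightarrow> z \<in> U \<Longrightarrow> \<exists>i. 0 < \<phi> i z \<and> {w \<in> topspace Z. 0 < \<phi> i w} \<subseteq> U"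
    by (rule separable_metrizable_cozero_base[OF Z]) blast
  define e where "e y = (\<lambda>i. \<phi> i (f y))" for y
  have "continuous_map Y euclideanreal (\<lambda>y. e y i)" for i
    using continuous_map_compose[OF f \<phi>_cont] by (simp add: e_def o_def)
  then have e: "continuous_map Y euclidean e"
    by (subst euclidean_product_topology[symmetric]) (simp add: continuous_map_componentwise_UNIV)
  have eK: "e ` topspace Y \<subseteq> UNIV \<rightarrow> {0..1}"
  proof -
    have "f y \<in> topspace Z" if "y \<in> topspace Y" for y
      using that surj by blast
    then show ?thesis
      using \<phi>_range by (simp add: e_def image_subset_iff Pi_iff)
  qed
  show "Hurewicz_space Z"
    unfolding Hurewicz_space_def
  proof (intro allI impI)
    fix \<U> :: "nat \<Rightarrow> 'b set set"
    assume "\<forall>n. open_cover Z (\<U> n)"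
    then have \<U>: "\<And>n U. U \<in> \<U> n \<Longrightarrow> openin Z U" "\<And>n. \<Union>(\<U> n) = topspace Z"
      by (auto simp: open_cover_def)
    define I where "I n = {i. \<exists>U\<in>\<U> n. {w \<in> topspace Z. 0 < \<phi> i w} \<subseteq> U}" for n
    define u where "u n i = (SOME U. U \<in> \<U> n \<and> {w \<in> topspace Z. 0 < \<phi> i w} \<subseteq> U)" for n i
    have "u n i \<in> \<U> n \<and> {w \<in> topspace Z. 0 < \<phi> i w} \<subseteq> u n i" if "i \<in> I n" for n i
      unfolding u_def by (rule someI_ex) (use that in \<open>simp add: I_def Bex_def\<close>)
    then have u: "\<And>n i. i \<in> I n \<Longrightarrow> u n i \<in> \<U> n" "\<And>n i. i \<in> I n \<Longrightarrow> {w \<in> topspace Z. 0 < \<phi> i w} \<subseteq> u n i"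
      by blast+
    define G where "G n k = (\<Union>i\<in>I n \<inter> {..k}. {t :: nat \<Rightarrow> real. 0 < t i})" for n k
    have "\<exists>c. \<forall>y\<in>topspace Y. \<forall>\<^sub>F n in sequentially. e y \<in> G n (c n)"
    proof (rule bounding_transfer[OF X T T' inv e _ eK])
      show "compact ((UNIV :: nat set) \<rightarrow> {0..1 :: real})"
        by (intro compact_Pi_UNIV compact_Icc)
      show "open (G n k)" for n k
        unfolding G_def
        by (intro open_UN ballI open_Collect_less continuous_on_const
            continuous_on_product_then_coordinatewise[OF continuous_on_id])
      show "G n k \<subseteq> G n k'" if "k \<le> k'" for n k k'
        using that by (fastforce simp: G_def)
      show "\<exists>k. e y \<in> G n k" if y: "y \<in> topspace Y" for y n
      proof -
        have "f y \<in> \<Union>(\<U> n)"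
          using y surj \<U>(2) by auto
        then obtain U where "U \<in> \<U> n" "f y \<in> U"
          by blast
        then obtain i where "0 < \<phi> i (f y)" "i \<in> I n"
          using \<phi>_base[OF \<U>(1)] unfolding I_def by blast
        then show ?thesis
          by (intro exI[of _ i]) (auto simp: G_def e_def)
      qed
    qed auto
    then obtain c where c: "\<And>y. y \<in> topspace Y \<Longrightarrow> \<forall>\<^sub>F n in sequentially. e y \<in> G n (c n)"
      by blast
    show "\<exists>\<V>. (\<forall>n. finite (\<V> n) \<and> \<V> n \<subseteq> \<U> n) \<and>
        (\<forall>z\<in>topspace Z. \<forall>\<^sub>F n in sequentially. z \<in> \<Union>(\<V> n))"
    proof (intro exI[of _ "\<lambda>n. u n ` (I n \<inter> {..c n})"] conjI allI ballI)
      show "finite (u n ` (I n \<inter> {..c n}))" "u n ` (I n \<inter> {..c n}) \<subseteq> \<U> n" for n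
        using u(1) by auto
      fix z
      assume "z \<in> topspace Z"
      then obtain y where y: "y \<in> topspace Y" "z = f y"
        using surj by blast
      show "\<forall>\<^sub>F n in sequentially. z \<in> \<Union>(u n ` (I n \<inter> {..c n}))"
        using c[OF y(1)]
      proof (rule eventually_mono)
        fix n
        assume "e y \<in> G n (c n)"
        then obtain i where "i \<in> I n" "i \<le> c n" "0 < \<phi> i z"
          by (auto simp: G_def e_def y)
        then show "z \<in> \<Union>(u n ` (I n \<inter> {..c n}))"
          using u(2)[of i n] \<open>z \<in> topspace Z\<close> by blast
      qed
    qed
  qed
qed

theorem theorem3p5:
  fixes X :: "'a topology" and Y :: "'b topology"
  assumes "Tychonoff_space X" and "Tychonoff_space Y"
    and "Cp X homeomorphic_space Cp Y"
  shows "projectively_Hurewicz_space X \<longleftrightarrow> projectively_Hurewicz_space Y"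
proof -
  obtain T' T where "homeomorphic_maps (Cp X) (Cp Y) T' T"
    using assms(3) unfolding homeomorphic_space_def by blast
  then have T': "continuous_map (Cp X) (Cp Y) T'" and T: "continuous_map (Cp Y) (Cp X) T"
    and inv: "\<And>f. f \<in> topspace (Cp X) \<Longrightarrow> T (T' f) = f" "\<And>g. g \<in> topspace (Cp Y) \<Longrightarrow> T' (T g) = g"
    unfolding homeomorphic_maps_def by blast+
  show ?thesis
  proof
    show "projectively_Hurewicz_space Y" if "projectively_Hurewicz_space X"
      by (rule projectively_Hurewicz_space_transfer[where T = T and T' = T', OF that T T']) (rule inv(2))
    show "projectively_Hurewicz_space X" if "projectively_Hurewicz_space Y"
      by (rule projectively_Hurewicz_space_transfer[where T = T' and T' = T, OF that T' T]) (rule inv(1))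
  qed
qed

end
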